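(* Let $n \geq 7$ be odd. Then the circulant graph $C(n,\{1,3\})$ is nearly dispersable.
   Context: All graphs are finite and simple. For a set $S=\{i_1<\cdots<i_k\}$ of integers with $k\ge 1$, $1\le i_1$ and $i_k\le \lfloor n/2\rfloor$, the circulant $C(n,S)$ is the graph on vertex set $\{1,\ldots,n\}$ in which each $j$ is adjacent to $j+i_r$ (addition mod $n$) for $r=1,\ldots,k$. Given a graph $G$ and a cyclic order $\omega$ on $V(G)$, draw the vertices on a circle in the order $\omega$ and the edges as straight chords; two edges cross if they intersect at a point that is not an endpoint. A matching book embedding $(G,\omega,c)$ consists of $G$, a cyclic order $\omega$, and an edge-coloring $c$ (the color classes are the pages) such that any two distinct edges of the same color neither cross nor share an endpoint. The embedding is dispersable if the number of colors equals the maximum degree $\Delta(G)$, and nearly dispersable if the number of colors equals $1+\Delta(G)$. A graph is dispersable if it has a dispersable matching book embedding; it is nearly dispersable if it is not dispersable and has a nearly dispersable matching book embedding. *)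

theory Defs
  imports "HOL-Analysis.Analysis" "HOL-Number_Theory.Cong"
begin

text \<open>A graph is a pair of a vertex set and a set of edges, an edge being the set of its two endpoints.\<close>

type_synonym 'a graph = "'a set \<times> 'a set set"

abbreviation verts :: "'a graph \<Rightarrow> 'a set" where "verts G \<equiv> fst G"

abbreviation edges :: "'a graph \<Rightarrow> 'a set set" where "edges G \<equiv> snd G"

definition finite_simple_graph :: "'a graph \<Rightarrow> bool" where
  "finite_simple_graph G \<longleftrightarrow>
     finite (verts G) \<and> (\<forall>e\<in>edges G. e \<subseteq> verts G \<and> card e = 2)"

definition vertex_degree :: "'a graph \<Rightarrow> 'a \<Rightarrow> nat" where
  "vertex_degree G v = card {e \<in> edges G. v \<in> e}"

definition max_degree :: "'a graph \<Rightarrow> nat" where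
  "max_degree G = Max (vertex_degree G ` verts G)"

text \<open>
  Intended for \<open>S \<subseteq> {1..n div 2}\<close>. Addition modulo \<open>n\<close> takes its values in the
  representatives \<open>{1..n}\<close>.
\<close>

definition circulant :: "nat \<Rightarrow> nat set \<Rightarrow> nat graph" where
  "circulant n S =
     ({1..n}, {{j, k} | j k. j \<in> {1..n} \<and> k \<in> {1..n} \<and> (\<exists>i\<in>S. [k = j + i] (mod n))})"

lemma finite_simple_graph_circulant:
  assumes "S \<subseteq> {1..n div 2}"
  shows "finite_simple_graph (circulant n S)"
proof -
  have "j \<noteq> k" if "i \<in> S" "[k = j + i] (mod n)" for i j k
  proof
    assume "j = k"
    with that(2) have "[j + 0 = j + i] (mod n)" by simp
    then have "[0 = i] (mod n)" by (simp only: cong_add_lcancel_nat)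
    then have "n dvd i" by (metis cong_0_iff cong_sym)
    moreover have "1 \<le> i" "i \<le> n div 2" using assms that(1) by auto
    ultimately show False by (auto dest: dvd_imp_le)
  qed
  then show ?thesis
    by (fastforce simp: finite_simple_graph_def circulant_def card_2_iff)
qed

text \<open>
  A cyclic order on the vertices is represented by numbering them
  \<open>0, \<dots>, card (verts G) - 1\<close> in the order in which they occur around the circle;
  numberings that differ by a rotation represent the same cyclic order.
  The vertices are drawn equally spaced on the unit circle of the complex plane
  (whether two chords cross depends only on the order).
\<close>

definition cyclic_order :: "'a graph \<Rightarrow> ('a \<Rightarrow> nat) \<Rightarrow> bool" where
  "cyclic_order G \<omega> \<longleftrightarrow> bij_betw \<omega> (verts G) {..<card (verts G)}"

definition vertex_point :: "'a graph \<Rightarrow> ('a \<Rightarrow> nat) \<Rightarrow> 'a \<Rightarrow> complex" where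
  "vertex_point G \<omega> v = cis (2 * pi * real (\<omega> v) / real (card (verts G)))"

definition chord :: "'a graph \<Rightarrow> ('a \<Rightarrow> nat) \<Rightarrow> 'a set \<Rightarrow> complex set" where
  "chord G \<omega> e = convex hull (vertex_point G \<omega> ` e)"

definition crossing :: "'a graph \<Rightarrow> ('a \<Rightarrow> nat) \<Rightarrow> 'a set \<Rightarrow> 'a set \<Rightarrow> bool" where
  "crossing G \<omega> e f \<longleftrightarrow>
     (\<exists>x \<in> chord G \<omega> e \<inter> chord G \<omega> f. x \<notin> vertex_point G \<omega> ` (e \<union> f))"

definition matching_book_embedding ::
    "'a graph \<Rightarrow> ('a \<Rightarrow> nat) \<Rightarrow> ('a set \<Rightarrow> nat) \<Rightarrow> bool" where
  "matching_book_embedding G \<omega> c \<longleftrightarrow>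
     cyclic_order G \<omega> \<and>
     (\<forall>e\<in>edges G. \<forall>f\<in>edges G. e \<noteq> f \<and> c e = c f \<longrightarrow> \<not> crossing G \<omega> e f \<and> e \<inter> f = {})"

definition num_pages :: "'a graph \<Rightarrow> ('a set \<Rightarrow> nat) \<Rightarrow> nat" where
  "num_pages G c = card (c ` edges G)"

definition dispersable :: "'a graph \<Rightarrow> bool" where
  "dispersable G \<longleftrightarrow>
     (\<exists>\<omega> c. matching_book_embedding G \<omega> c \<and> num_pages G c = max_degree G)"

definition nearly_dispersable :: "'a graph \<Rightarrow> bool" where
  "nearly_dispersable G \<longleftrightarrow>
     \<not> dispersable G \<and>
     (\<exists>\<omega> c. matching_book_embedding G \<omega> c \<and> num_pages G c = 1 + max_degree G)"

end

theory Submission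
  imports Defs
begin

text \<open>
  If a \<open>4\<close>-regular graph had only \<open>4\<close> pages, every page would meet every vertex and hence
  be a perfect matching, which is impossible on an odd number of vertices. For the upper bound start from embeddings of
  \<open>C(7, {1, 3})\<close>, with the vertices in the order \<open>1, 2, 3, 5, 4, 6, 7\<close>, and of
  \<open>C(9, {1, 3})\<close>, with the vertices in their natural order, in five pages, such that the edges
  \<open>{1, n}\<close> and \<open>{2, n - 1}\<close> share a page. Four new vertices can then be inserted between \<open>n\<close>
  and \<open>1\<close>, in natural order: the edges over the gap need no further page, because in the
  natural order an edge of jump \<open>1\<close> can be nested in an edge of jump \<open>3\<close>, and four pages of such
  nested pairs suffice.
\<close>

section \<open>Chords and pages\<close>

text \<open>Cosine decreases on \<open>[0, pi]\<close>. Outside the arc, the distance \<delta> from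
  \<theta> to the midpoint and its complement \<open>2 * pi - \<delta>\<close> both exceed half the
  arc, and one of them is at most \<open>pi\<close>.\<close>

lemma cos_less_cos_half_arc:
  fixes \<alpha> \<beta> \<theta> :: real
  assumes "0 \<le> \<alpha>" "\<alpha> < \<beta>" "\<beta> < 2 * pi" "0 \<le> \<theta>" "\<theta> < 2 * pi" "\<theta> < \<alpha> \<or> \<beta> < \<theta>"
  shows "cos (\<theta> - (\<alpha> + \<beta>) / 2) < cos ((\<beta> - \<alpha>) / 2)"
proof -
  define \<delta> where "\<delta> = \<bar>\<theta> - (\<alpha> + \<beta>) / 2\<bar>"
  have cos: "cos (\<theta> - (\<alpha> + \<beta>) / 2) = cos \<delta>"
    by (simp add: \<delta>_def abs_if flip: cos_minus[of "\<theta> - (\<alpha> + \<beta>) / 2"])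
  have lower: "(\<beta> - \<alpha>) / 2 < \<delta>" and upper: "(\<beta> - \<alpha>) / 2 < 2 * pi - \<delta>"
    using assms by (auto simp: \<delta>_def abs_if field_simps)
  show ?thesis
  proof (cases "\<delta> \<le> pi")
    case True
    then show ?thesis
      unfolding cos using lower assms by (intro cos_monotone_0_pi) auto
  next
    case False
    then have "cos (2 * pi - \<delta>) < cos ((\<beta> - \<alpha>) / 2)"
      using upper assms by (intro cos_monotone_0_pi) auto
    then show ?thesis
      unfolding cos by (simp add: cos_diff)
  qed
qed

text \<open>Inside the arc the distance to the midpoint is less than half the arc, which is below
  \<open>pi\<close>, where cosine decreases.\<close>

lemma cos_greater_cos_half_arc:
  fixes \<alpha> \<beta> \<theta> :: real
  assumes "0 \<le> \<alpha>" "\<beta> < 2 * pi" "\<alpha> < \<theta>" "\<theta> < \<beta>"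
  shows "cos ((\<beta> - \<alpha>) / 2) < cos (\<theta> - (\<alpha> + \<beta>) / 2)"
proof -
  have "cos ((\<beta> - \<alpha>) / 2) < cos \<bar>\<theta> - (\<alpha> + \<beta>) / 2\<bar>"
    using assms by (intro cos_monotone_0_pi) (auto simp: abs_if field_simps)
  then show ?thesis
    by simp
qed

lemma inner_cis: "inner (cis \<mu>) (cis \<theta>) = cos (\<theta> - \<mu>)"
  by (simp add: inner_complex_def cos_diff mult.commute)

text \<open>The line through the endpoints of the first chord has both endpoints of the second
  chord strictly on one side.\<close>

lemma chords_disjoint:
  fixes \<alpha> \<beta> \<gamma> \<delta> :: real
  assumes "0 \<le> \<alpha>" "\<alpha> < \<beta>" "\<beta> < 2 * pi" "0 \<le> \<gamma>" "\<gamma> < 2 * pi" "0 \<le> \<delta>" "\<delta> < 2 * pi"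
    and "\<alpha> < \<gamma> \<and> \<gamma> < \<beta> \<and> \<alpha> < \<delta> \<and> \<delta> < \<beta> \<or>
         (\<gamma> < \<alpha> \<or> \<beta> < \<gamma>) \<and> (\<delta> < \<alpha> \<or> \<beta> < \<delta>)"
  shows "convex hull {cis \<alpha>, cis \<beta>} \<inter> convex hull {cis \<gamma>, cis \<delta>} = {}"
proof -
  \<comment> \<open>\<open>w\<close> is the unit normal of the line through the endpoints of the
    first chord, directed at the midpoint of its arc; \<open>t\<close> is the signed distance of
    that line from the origin.\<close>
  define w t where "w = cis ((\<alpha> + \<beta>) / 2)" and "t = cos ((\<beta> - \<alpha>) / 2)"
  have "\<alpha> - (\<alpha> + \<beta>) / 2 = - ((\<beta> - \<alpha>) / 2)" "\<beta> - (\<alpha> + \<beta>) / 2 = (\<beta> - \<alpha>) / 2"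
    by (simp_all add: field_simps)
  then have "cos (\<alpha> - (\<alpha> + \<beta>) / 2) = t" "cos (\<beta> - (\<alpha> + \<beta>) / 2) = t"
    by (simp_all only: t_def cos_minus)
  then have line: "convex hull {cis \<alpha>, cis \<beta>} \<subseteq> {z. inner w z = t}"
    by (intro hull_minimal) (auto simp: w_def inner_cis convex_hyperplane)
  show ?thesis
  proof (cases "\<alpha> < \<gamma> \<and> \<gamma> < \<beta> \<and> \<alpha> < \<delta> \<and> \<delta> < \<beta>")
    case True
    then have "convex hull {cis \<gamma>, cis \<delta>} \<subseteq> {z. inner w z > t}"
      using assms
      by (intro hull_minimal)
         (auto simp: w_def t_def inner_cis convex_halfspace_gt intro!: cos_greater_cos_half_arc)
    with line show ?thesis by fastforce
  next
    case False
    then have "convex hull {cis \<gamma>, cis \<delta>} \<subseteq> {z. inner w z < t}"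
      using assms
      by (intro hull_minimal)
         (auto simp: w_def t_def inner_cis convex_halfspace_lt intro!: cos_less_cos_half_arc)
    with line show ?thesis by fastforce
  qed
qed

section \<open>From separated pairs to book embeddings\<close>

text \<open>For pairs with increasing entries: disjoint or strictly nested intervals. Since all
  inequalities are strict, the one relation excludes both crossings and common endpoints.\<close>

definition separate :: "nat \<times> nat \<Rightarrow> nat \<times> nat \<Rightarrow> bool" where
  "separate p q \<longleftrightarrow>
     (case (p, q) of ((a, b), (c, d)) \<Rightarrow> b < c \<or> d < a \<or> a < c \<and> d < b \<or> c < a \<and> b < d)"

text \<open>Angles are ordered as the positions are. Of the two configurations in
  \<open>chords_disjoint\<close>, the first is the second chord nested in the first; the other
  covers disjoint intervals and the opposite nesting.\<close>

lemma not_crossing_if_separate: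
  assumes \<omega>: "cyclic_order G \<omega>" and fin: "finite (verts G)"
    and vs: "u \<in> verts G" "v \<in> verts G" "x \<in> verts G" "y \<in> verts G"
    and less: "\<omega> u < \<omega> v" "\<omega> x < \<omega> y"
    and sep: "separate (\<omega> u, \<omega> v) (\<omega> x, \<omega> y)"
  shows "\<not> crossing G \<omega> {u, v} {x, y}"
proof -
  define \<phi> where "\<phi> z = 2 * pi * real (\<omega> z) / real (card (verts G))" for z
  have pos: "card (verts G) > 0"
    using fin vs by (auto simp: card_gt_0_iff)
  have range: "0 \<le> \<phi> z" "\<phi> z < 2 * pi" if "z \<in> verts G" for z
  proof -
    have "\<omega> z < card (verts G)"
      using \<omega> that by (auto simp: cyclic_order_def dest: bij_betwE)
    then show "0 \<le> \<phi> z" "\<phi> z < 2 * pi"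
      using pos by (auto simp: \<phi>_def field_simps)
  qed
  have mono: "\<phi> z < \<phi> z' \<longleftrightarrow> \<omega> z < \<omega> z'" for z z'
    using pos by (auto simp: \<phi>_def divide_less_cancel)
  have "convex hull {cis (\<phi> u), cis (\<phi> v)} \<inter> convex hull {cis (\<phi> x), cis (\<phi> y)} = {}"
  proof (rule chords_disjoint)
    show "\<phi> u < \<phi> x \<and> \<phi> x < \<phi> v \<and> \<phi> u < \<phi> y \<and> \<phi> y < \<phi> v \<or>
          (\<phi> x < \<phi> u \<or> \<phi> v < \<phi> x) \<and> (\<phi> y < \<phi> u \<or> \<phi> v < \<phi> y)"
      using sep less unfolding mono separate_def by auto
  qed (use vs less range mono in auto)
  then show ?thesis
    by (auto simp: crossing_def chord_def vertex_point_def \<phi>_def)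
qed

text \<open>Reduces the geometry to finite sets of pairs of places. The pages need only cover the
  edges, because the coloring picks one page for each edge; hence only an upper bound on the pages
  used results.\<close>

lemma matching_book_embedding_if_separate_pages:
  fixes place :: "'a \<Rightarrow> nat" and page :: "nat \<Rightarrow> (nat \<times> nat) set"
  assumes G: "finite_simple_graph G" and place: "bij_betw place (verts G) {1..card (verts G)}"
    and less: "\<And>p a b. p \<in> P \<Longrightarrow> (a, b) \<in> page p \<Longrightarrow> a < b"
    and sep: "\<And>p. p \<in> P \<Longrightarrow> pairwise separate (page p)"
    and cover: "\<And>e. e \<in> edges G \<Longrightarrow> \<exists>p\<in>P. \<exists>u v. e = {u, v} \<and> (place u, place v) \<in> page p"
  shows "\<exists>\<omega> c. matching_book_embedding G \<omega> c \<and> c ` edges G \<subseteq> P"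
proof -
  \<comment> \<open>Places are counted from 1, positions in a cyclic order from 0.\<close>
  define \<omega> where "\<omega> v = place v - 1" for v
  have Suc_\<omega>: "place v = Suc (\<omega> v)" if "v \<in> verts G" for v
    using bij_betwE[OF place] that by (auto simp: \<omega>_def)
  have "bij_betw (\<lambda>a. a - 1) {1..card (verts G)} {..<card (verts G)}"
    by (rule bij_betwI[where g = Suc]) auto
  then have \<omega>: "cyclic_order G \<omega>"
    using bij_betw_trans[OF place] by (simp add: cyclic_order_def \<omega>_def[abs_def] comp_def)
  then have inj: "inj_on \<omega> (verts G)"
    by (simp add: cyclic_order_def bij_betw_def)
  obtain c where c: "\<And>e. e \<in> edges G \<Longrightarrow>
      c e \<in> P \<and> (\<exists>u v. e = {u, v} \<and> (place u, place v) \<in> page (c e))"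
    using cover by metis
  have "\<not> crossing G \<omega> e f \<and> e \<inter> f = {}"
    if e: "e \<in> edges G" and f: "f \<in> edges G" and ne: "e \<noteq> f" and eq: "c e = c f" for e f
  proof -
    obtain u v where uv: "e = {u, v}" "(place u, place v) \<in> page (c e)"
      using c[OF e] by blast
    obtain x y where xy: "f = {x, y}" "(place x, place y) \<in> page (c e)"
      using c[OF f] eq by auto
    have vs: "u \<in> verts G" "v \<in> verts G" "x \<in> verts G" "y \<in> verts G"
      using G e f uv(1) xy(1) by (auto simp: finite_simple_graph_def)
    have p: "c e \<in> P"
      using c[OF e] by blast
    have lt: "\<omega> u < \<omega> v" "\<omega> x < \<omega> y"
      using less[OF p uv(2)] less[OF p xy(2)] vs by (simp_all add: Suc_\<omega>)
    \<comment> \<open>\<open>pairwise\<close> relates only distinct pairs; distinct edges give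
      distinct pairs because places are injective.\<close>
    have "(place u, place v) \<noteq> (place x, place y)"
      using ne uv(1) xy(1) vs inj by (auto simp: Suc_\<omega> inj_on_eq_iff)
    then have "separate (place u, place v) (place x, place y)"
      using sep[OF p] uv(2) xy(2) by (auto simp: pairwise_def)
    then have sp: "separate (\<omega> u, \<omega> v) (\<omega> x, \<omega> y)"
      using vs by (simp add: Suc_\<omega> separate_def)
    have "\<not> crossing G \<omega> e f"
      unfolding uv(1) xy(1)
      using not_crossing_if_separate[OF \<omega> _ vs lt sp] G by (simp add: finite_simple_graph_def)
    moreover have "e \<inter> f = {}"
      using sp lt unfolding uv(1) xy(1) separate_def by auto
    ultimately show ?thesis ..
  qed
  then have "matching_book_embedding G \<omega> c"
    using \<omega> by (auto simp: matching_book_embedding_def)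
  then show ?thesis
    using c by blast
qed

section \<open>The parity lower bound\<close>

lemma odd_regular_graph_num_pages:
  assumes G: "finite_simple_graph G" and odd: "odd (card (verts G))"
    and reg: "\<And>v. v \<in> verts G \<Longrightarrow> vertex_degree G v = d" and "d > 0"
    and emb: "matching_book_embedding G \<omega> c"
  shows "d < num_pages G c"
proof (rule ccontr)
  assume "\<not> d < num_pages G c"
  then have le: "card (c ` edges G) \<le> d"
    by (simp add: num_pages_def)
  have "finite (edges G)"
    using G by (auto simp: finite_simple_graph_def intro: finite_subset[of _ "Pow (verts G)"])
  \<comment> \<open>The \<open>d\<close> edges at \<open>v\<close> share an endpoint, so their pages
    are distinct; as there are at most \<open>d\<close> pages, all of them occur at
    \<open>v\<close>.\<close>
  have all_pages: "c ` {e \<in> edges G. v \<in> e} = c ` edges G" if "v \<in> verts G" for v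
  proof (rule card_subset_eq)
    have "inj_on c {e \<in> edges G. v \<in> e}"
      using emb by (fastforce simp: matching_book_embedding_def inj_on_def)
    then have "card (c ` {e \<in> edges G. v \<in> e}) = d"
      using reg[OF that] by (simp add: card_image vertex_degree_def)
    moreover have "card (c ` {e \<in> edges G. v \<in> e}) \<le> card (c ` edges G)"
      using \<open>finite (edges G)\<close> by (intro card_mono) auto
    ultimately show "card (c ` {e \<in> edges G. v \<in> e}) = card (c ` edges G)"
      using le by simp
  qed (use \<open>finite (edges G)\<close> in auto)
  obtain v where "v \<in> verts G"
    using odd by (metis card.empty equals0I even_zero)
  then have "edges G \<noteq> {}"
    using reg[of v] \<open>d > 0\<close> by (auto simp: vertex_degree_def)
  then obtain p where p: "p \<in> c ` edges G"
    by blast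
  define M where "M = {e \<in> edges G. c e = p}"
  have "\<Union>M = verts G"
  proof
    show "\<Union>M \<subseteq> verts G"
      using G by (auto simp: M_def finite_simple_graph_def)
    show "verts G \<subseteq> \<Union>M"
    proof
      fix v assume "v \<in> verts G"
      then have "p \<in> c ` {e \<in> edges G. v \<in> e}"
        using all_pages p by blast
      then show "v \<in> \<Union>M"
        by (auto simp: M_def)
    qed
  qed
  moreover have "card (\<Union>M) = sum card M"
    using emb G
    by (intro card_Union_disjoint)
       (auto simp: M_def pairwise_def disjnt_def matching_book_embedding_def
             finite_simple_graph_def intro: card_ge_0_finite)
  moreover have "sum card M = 2 * card M"
    using G by (simp add: M_def finite_simple_graph_def)
  ultimately show False
    using odd by simp
qed

section \<open>The circulant with jumps 1 and 3\<close>

text \<open>In these ranges \<open>k\<close> exceeds \<open>j + i\<close> by less than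
  \<open>n\<close>, and \<open>j + i\<close> exceeds \<open>k\<close> by less than
  \<open>2 * n\<close>, so at most one wrap occurs. Writing it as \<open>k + n\<close> avoids
  truncated subtraction.\<close>

lemma cong_add_iff:
  fixes n i j k :: nat
  assumes "i < n" "j \<in> {1..n}" "k \<in> {1..n}"
  shows "[k = j + i] (mod n) \<longleftrightarrow> k = j + i \<or> k + n = j + i"
proof
  assume "[k = j + i] (mod n)"
  then have "(\<exists>q. k = q * n + (j + i)) \<or> (\<exists>q. j + i = q * n + k)"
    using cong_le_nat[of "j + i" k n] cong_le_nat[of k "j + i" n] cong_sym[of k "j + i" n]
    by (meson nat_le_linear)
  then consider q where "k = j + i + q * n" | q where "j + i = k + q * n"
    by (auto simp: add.commute)
  then show "k = j + i \<or> k + n = j + i"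
  proof cases
    case 1
    then have "q * n < n" using assms unfolding atLeastAtMost_iff by linarith
    then have "q = 0" by (cases q) auto
    then show ?thesis using 1 by simp
  next
    case 2
    then have "q * n < 2 * n" using assms unfolding atLeastAtMost_iff by linarith
    then have "q < 2" by simp
    then show ?thesis using 2 by (auto simp: less_2_cases_iff)
  qed
next
  assume "k = j + i \<or> k + n = j + i"
  then show "[k = j + i] (mod n)"
    unfolding cong_def by (metis mod_add_self2)
qed

lemma edges_circulant_1_3:
  assumes "n > 3"
  shows "edges (circulant n {1, 3}) =
    {{j, k} | j k. j \<in> {1..n} \<and> k \<in> {1..n} \<and>
       (k = j + 1 \<or> k + n = j + 1 \<or> k = j + 3 \<or> k + n = j + 3)}"
  unfolding circulant_def snd_conv using assms
  by (intro Collect_cong ex_cong1 conj_cong refl)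
     (simp only: bex_simps, simp add: cong_add_iff[where i = 1, simplified] cong_add_iff[where i = 3])

lemma vertex_degree_circulant_1_3:
  assumes "n \<ge> 7" "v \<in> {1..n}"
  shows "vertex_degree (circulant n {1, 3}) v = 4"
proof -
  \<comment> \<open>\<open>s i\<close> is \<open>v + i\<close> reduced into \<open>{1..n}\<close>;
    steps back by 1 and 3 become steps forward by \<open>n - 1\<close> and \<open>n - 3\<close>. The
    four offsets differ because \<open>1 < 3 < n - 3 < n - 1 < n\<close>.\<close>
  define s where "s i = (if v + i \<le> n then v + i else v + i - n)" for i
  have "{e \<in> edges (circulant n {1, 3}). v \<in> e} = (\<lambda>u. {v, u}) ` {s 1, s 3, s (n - 1), s (n - 3)}"
    (is "?L = ?R")
  proof
    show "?L \<subseteq> ?R"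
    proof
      fix e assume "e \<in> ?L"
      then obtain j k where jk: "e = {j, k}" "v = j \<or> v = k" "j \<in> {1..n}" "k \<in> {1..n}"
        "k = j + 1 \<or> k + n = j + 1 \<or> k = j + 3 \<or> k + n = j + 3"
        using edges_circulant_1_3[of n] assms by auto
      define u where "u = (if v = j then k else j)"
      have u: "u \<in> {1..n}" "e = {v, u}"
        "u = v + 1 \<or> u + n = v + 1 \<or> u = v + 3 \<or> u + n = v + 3 \<or>
         v = u + 1 \<or> v + n = u + 1 \<or> v = u + 3 \<or> v + n = u + 3"
        using jk by (auto simp: u_def)
      then have "u \<in> {s 1, s 3, s (n - 1), s (n - 3)}"
        using assms by (auto simp: s_def)
      with u(2) show "e \<in> ?R" by blast
    qed
    have mem: "{j, k} \<in> edges (circulant n {1, 3})"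
      if "j \<in> {1..n}" "k \<in> {1..n}" "k = j + 1 \<or> k + n = j + 1 \<or> k = j + 3 \<or> k + n = j + 3" for j k
      using that assms by (subst edges_circulant_1_3) auto
    have "{v, s i} \<in> edges (circulant n {1, 3})" if "i \<in> {1, 3}" for i
      by (rule mem) (use assms that in \<open>auto simp: s_def\<close>)
    \<comment> \<open>Here \<open>v\<close> is the forward neighbor of \<open>s (n - i)\<close>, so
      the edge is first obtained with its endpoints in this order.\<close>
    moreover have "{s (n - i), v} \<in> edges (circulant n {1, 3})" if "i \<in> {1, 3}" for i
      by (rule mem) (use assms that in \<open>auto simp: s_def\<close>)
    then have "{v, s (n - i)} \<in> edges (circulant n {1, 3})" if "i \<in> {1, 3}" for i
      using that by (simp add: insert_commute)
    ultimately show "?R \<subseteq> ?L"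
      by auto
  qed
  moreover have "card {s 1, s 3, s (n - 1), s (n - 3)} = 4"
  proof -
    have "s 1 \<noteq> s 3" "s 1 \<noteq> s (n - 1)" "s 1 \<noteq> s (n - 3)"
      "s 3 \<noteq> s (n - 1)" "s 3 \<noteq> s (n - 3)" "s (n - 1) \<noteq> s (n - 3)"
      using assms by (auto simp: s_def split: if_splits)
    then show ?thesis by simp
  qed
  moreover have "card ((\<lambda>u. {v, u}) ` A) = card A" for A
    by (intro card_image) (auto simp: inj_on_def doubleton_eq_iff)
  ultimately show ?thesis
    by (simp only: vertex_degree_def)
qed

section \<open>The five pages\<close>

text \<open>The places from \<open>r\<close> to \<open>4 * m + r - 1\<close> split into
  \<open>m\<close> blocks of four, each carrying a jump 3 with a jump 1 nested inside. The starts
  \<open>r = 1, 2, 3, 4\<close> represent all residues mod 4.\<close>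

definition bulk :: "nat \<Rightarrow> nat \<Rightarrow> (nat \<times> nat) set" where
  "bulk m r =
     {(4 * q + r, 4 * q + r + 3) | q. q < m} \<union> {(4 * q + r + 1, 4 * q + r + 2) | q. q < m}"

text \<open>Entries are places on the circle, counted from \<open>1\<close>, not vertices: in the embedding for
  \<open>n = 4 * m + 7\<close> the vertices \<open>4 * m + 4\<close> and \<open>4 * m + 5\<close> have changed places.\<close>

definition page7 :: "nat \<Rightarrow> nat \<Rightarrow> (nat \<times> nat) set" where
  "page7 m p = (let M = 4 * m in
     [bulk m 3 \<union> {(1, M + 7), (2, M + 6), (M + 3, M + 5)},
      bulk m 1 \<union> {(M + 3, M + 6), (M + 4, M + 5)},
      {(M + 1, M + 5), (M + 2, M + 4), (M + 6, M + 7)},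
      bulk m 2 \<union> {(1, M + 4), (M + 2, M + 3), (M + 5, M + 7)},
      bulk m 4 \<union> {(1, 2), (3, M + 7), (M + 4, M + 6)}] ! p)"

text \<open>For \<open>m = 0\<close> the bulks are empty and these are the pages of
  \<open>C(9, {1, 3})\<close>. In general each extra pair lies before, after or around the bulk of
  its page; the four bulks go on four pages, leaving page 2 without one.\<close>

definition page9 :: "nat \<Rightarrow> nat \<Rightarrow> (nat \<times> nat) set" where
  "page9 m p = (let M = 4 * m in
     [bulk m 3 \<union> {(1, M + 9), (2, M + 8), (M + 3, M + 6), (M + 4, M + 5)},
      bulk m 4 \<union> {(1, 2), (3, M + 9), (M + 4, M + 7), (M + 5, M + 6)},
      {(M + 1, M + 4), (M + 2, M + 3), (M + 5, M + 8), (M + 6, M + 7)},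
      bulk m 2 \<union> {(1, M + 7), (M + 2, M + 5), (M + 3, M + 4), (M + 8, M + 9)},
      bulk m 1 \<union> {(M + 6, M + 9), (M + 7, M + 8)}] ! p)"

lemma bulk_bounds: "(a, b) \<in> bulk m r \<Longrightarrow> r \<le> a \<and> a < b \<and> b < 4 * m + r"
  by (auto simp: bulk_def)

lemma separate_sym: "separate p q \<longleftrightarrow> separate q p"
  by (auto simp: separate_def)

text \<open>Two pairs of one block are nested; different blocks occupy disjoint stretches of four
  places.\<close>

lemma pairwise_separate_bulk: "pairwise separate (bulk m r)"
proof -
  have "separate x y" if "x \<in> bulk m r" "y \<in> bulk m r" "x \<noteq> y" for x y
  proof -
    have "\<exists>k. x = (4 * k + r, 4 * k + r + 3) \<or> x = (4 * k + r + 1, 4 * k + r + 2)"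
      using that(1) by (auto simp: bulk_def)
    then obtain k where x: "x = (4 * k + r, 4 * k + r + 3) \<or> x = (4 * k + r + 1, 4 * k + r + 2)"
      by blast
    have "\<exists>l. y = (4 * l + r, 4 * l + r + 3) \<or> y = (4 * l + r + 1, 4 * l + r + 2)"
      using that(2) by (auto simp: bulk_def)
    then obtain l where y: "y = (4 * l + r, 4 * l + r + 3) \<or> y = (4 * l + r + 1, 4 * l + r + 2)"
      by blast
    show ?thesis
    proof (cases "k = l")
      case True
      then show ?thesis
        using x y that(3) by (auto simp: separate_def)
    next
      case False
      then have "k + 1 \<le> l \<or> l + 1 \<le> k"
        by linarith
      then have "4 * k + 4 \<le> 4 * l \<or> 4 * l + 4 \<le> 4 * k"
        by linarith
      then show ?thesis
        using x y by (elim disjE) (simp_all add: separate_def)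
    qed
  qed
  then show ?thesis
    by (auto simp: pairwise_def)
qed

text \<open>Each pair of \<open>A\<close> avoids the stretch of places of the bulk or encloses it,
  so no conflict between the two sets can arise.\<close>

lemma pairwise_separate_bulk_Un:
  assumes "pairwise separate A"
    and "\<forall>(a, b)\<in>A. b < r \<or> 4 * m + r \<le> a \<or> a < r \<and> 4 * m + r \<le> b"
  shows "pairwise separate (bulk m r \<union> A)"
proof -
  have "separate x y" if "x \<in> A" "y \<in> bulk m r" for x y
    using that assms(2) bulk_bounds[of "fst y" "snd y" m r]
    by (cases x; cases y) (fastforce simp: separate_def)
  then show ?thesis
    using assms(1) pairwise_separate_bulk[of m r] separate_sym unfolding pairwise_def by blast
qed

lemma less_5_iff: "p < (5::nat) \<longleftrightarrow> p = 0 \<or> p = 1 \<or> p = 2 \<or> p = 3 \<or> p = 4"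
  by auto

lemma page7_eqs:
  "page7 m 0 = bulk m 3 \<union> {(1, 4 * m + 7), (2, 4 * m + 6), (4 * m + 3, 4 * m + 5)}"
  "page7 m 1 = bulk m 1 \<union> {(4 * m + 3, 4 * m + 6), (4 * m + 4, 4 * m + 5)}"
  "page7 m 2 = {(4 * m + 1, 4 * m + 5), (4 * m + 2, 4 * m + 4), (4 * m + 6, 4 * m + 7)}"
  "page7 m 3 = bulk m 2 \<union> {(1, 4 * m + 4), (4 * m + 2, 4 * m + 3), (4 * m + 5, 4 * m + 7)}"
  "page7 m 4 = bulk m 4 \<union> {(1, 2), (3, 4 * m + 7), (4 * m + 4, 4 * m + 6)}"
  by (simp_all add: page7_def Let_def)

lemma page9_eqs:
  "page9 m 0 = bulk m 3 \<union>
     {(1, 4 * m + 9), (2, 4 * m + 8), (4 * m + 3, 4 * m + 6), (4 * m + 4, 4 * m + 5)}"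
  "page9 m 1 = bulk m 4 \<union>
     {(1, 2), (3, 4 * m + 9), (4 * m + 4, 4 * m + 7), (4 * m + 5, 4 * m + 6)}"
  "page9 m 2 =
     {(4 * m + 1, 4 * m + 4), (4 * m + 2, 4 * m + 3), (4 * m + 5, 4 * m + 8), (4 * m + 6, 4 * m + 7)}"
  "page9 m 3 = bulk m 2 \<union>
     {(1, 4 * m + 7), (4 * m + 2, 4 * m + 5), (4 * m + 3, 4 * m + 4), (4 * m + 8, 4 * m + 9)}"
  "page9 m 4 = bulk m 1 \<union> {(4 * m + 6, 4 * m + 9), (4 * m + 7, 4 * m + 8)}"
  by (simp_all add: page9_def Let_def)

lemma pairwise_separate_page7:
  assumes "p < 5"
  shows "pairwise separate (page7 m p)"
proof -
  have "pairwise separate (page7 m 0)" "pairwise separate (page7 m 1)"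
    "pairwise separate (page7 m 2)" "pairwise separate (page7 m 3)" "pairwise separate (page7 m 4)"
    unfolding page7_eqs
    \<comment> \<open>The rule is optional because page 2 contains no bulk.\<close>
    by ((rule pairwise_separate_bulk_Un)?; auto simp: pairwise_def separate_def)+
  then show ?thesis
    using assms unfolding less_5_iff by blast
qed

lemma pairwise_separate_page9:
  assumes "p < 5"
  shows "pairwise separate (page9 m p)"
proof -
  have "pairwise separate (page9 m 0)" "pairwise separate (page9 m 1)"
    "pairwise separate (page9 m 2)" "pairwise separate (page9 m 3)" "pairwise separate (page9 m 4)"
    unfolding page9_eqs
    by ((rule pairwise_separate_bulk_Un)?; auto simp: pairwise_def separate_def)+
  then show ?thesis
    using assms unfolding less_5_iff by blast
qed

lemma page7_less: "p < 5 \<Longrightarrow> (a, b) \<in> page7 m p \<Longrightarrow> a < b"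
  unfolding less_5_iff by (auto simp: page7_eqs[simplified] dest: bulk_bounds)

lemma page9_less: "p < 5 \<Longrightarrow> (a, b) \<in> page9 m p \<Longrightarrow> a < b"
  unfolding less_5_iff by (auto simp: page9_eqs[simplified] dest: bulk_bounds)

section \<open>Every edge lies on a page\<close>

lemma bulk_decomp:
  fixes j m :: nat
  assumes "0 < j" "j \<le> 4 * m"
  obtains q r where "q < m" "r \<in> {1, 2, 3, 4}" "j = 4 * q + r"
proof
  show "(j - 1) div 4 < m" "j = 4 * ((j - 1) div 4) + ((j - 1) mod 4 + 1)"
    using assms by auto
  show "(j - 1) mod 4 + 1 \<in> {1, 2, 3, 4}"
    by auto
qed

text \<open>With \<open>j = 4 * q + r\<close> and \<open>r\<close> from 1 to 4, both pairs form
  block \<open>q\<close> of \<open>bulk m r\<close>.\<close>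

lemma bulk_covered:
  assumes bulk: "\<And>r. r \<in> {1, 2, 3, 4} \<Longrightarrow> \<exists>p\<in>P. bulk m r \<subseteq> page p"
    and j: "0 < j" "j \<le> 4 * m"
  shows "\<exists>p\<in>P. (j, j + 3) \<in> page p" "\<exists>p\<in>P. (j + 1, j + 2) \<in> page p"
proof -
  obtain q r where qr: "q < m" "r \<in> {1, 2, 3, 4}" "j = 4 * q + r"
    using bulk_decomp[OF j] .
  then have "(j, j + 3) \<in> bulk m r" "(j + 1, j + 2) \<in> bulk m r"
    by (auto simp: bulk_def)
  then show "\<exists>p\<in>P. (j, j + 3) \<in> page p" "\<exists>p\<in>P. (j + 1, j + 2) \<in> page p"
    using bulk[OF qr(2)] by blast+
qed

text \<open>Sorts the edges as the pages list them: the two kinds of bulk edges, then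
  \<open>{1, 2}\<close> and the four wrapping edges, then jumps 3 and 1 among the last
  \<open>b\<close> vertices. The final case starts at \<open>i = 2\<close> because
  \<open>{4 * m + 1, 4 * m + 2}\<close> is a bulk edge, or \<open>{1, 2}\<close> if
  \<open>m = 0\<close>.\<close>

lemma circulant_1_3_edge_cases:
  fixes b m :: nat
  defines "n \<equiv> 4 * m + b"
  assumes e: "e \<in> edges (circulant n {1, 3})" and b: "b \<ge> 7"
  obtains j where "0 < j" "j \<le> 4 * m" "e = {j, j + 3}"
    | j where "0 < j" "j \<le> 4 * m" "e = {j + 1, j + 2}"
    | "e = {1, 2}" | "e = {1, n}" | "e = {1, n - 2}" | "e = {2, n - 1}" | "e = {3, n}"
    | i where "0 < i" "i + 3 \<le> b" "e = {4 * m + i, 4 * m + i + 3}"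
    | i where "1 < i" "i + 1 \<le> b" "e = {4 * m + i, 4 * m + i + 1}"
proof -
  have n: "n = 4 * m + b" "b \<ge> 7"
    using b by (simp_all add: n_def)
  obtain j k where jk: "e = {j, k}" "0 < j" "j \<le> n" "0 < k" "k \<le> n"
    "k = j + 1 \<or> k + n = j + 1 \<or> k = j + 3 \<or> k + n = j + 3"
    using e n edges_circulant_1_3[of n] by auto
  from jk(6) consider (short) "k = j + 1" | (wrap1) "k + n = j + 1"
    | (long) "k = j + 3" | (wrap3) "k + n = j + 3"
    by blast
  then show thesis
  proof cases
    case short
    \<comment> \<open>That is, \<open>j = 1\<close>, \<open>2 \<le> j \<le> 4 * m + 1\<close> or
      \<open>j \<ge> 4 * m + 2\<close>.\<close>
    then consider "j = 1" | "0 < j - 1" "j - 1 \<le> 4 * m" | "1 < j - 4 * m" "j = 4 * m + (j - 4 * m)"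
      using jk(2) by linarith
    then show thesis
    proof cases
      case 1
      then show thesis using short jk(1) that(3) by (simp add: numeral_2_eq_2)
    next
      case 2
      then show thesis using short jk(1) that(2)[of "j - 1"] by simp
    next
      case 3
      then show thesis using short jk(1,5) n that(9)[of "j - 4 * m"] by simp
    qed
  next
    case wrap1
    then have "j = n" "k = 1" using jk by auto
    then show thesis using jk(1) that(4) by (simp add: insert_commute)
  next
    case long
    show thesis
      using long jk n that(1)[of j] that(8)[of "j - 4 * m"] by (cases "j \<le> 4 * m") auto
  next
    case wrap3
    then consider "k = 1" "j = n - 2" | "k = 2" "j = n - 1" | "k = 3" "j = n"
      using jk n by force
    then show thesis
      using jk(1) that(5,6,7) by cases (simp_all add: insert_commute)
  qed
qed

definition place7 :: "nat \<Rightarrow> nat \<Rightarrow> nat" where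
  "place7 m v = (if v = 4 * m + 4 then 4 * m + 5 else if v = 4 * m + 5 then 4 * m + 4 else v)"

lemma bij_betw_place7: "bij_betw (place7 m) {1..4 * m + 7} {1..4 * m + 7}"
  by (rule bij_betwI[where g = "place7 m"]) (auto simp: place7_def)

lemma page7_bulk: "r \<in> {1, 2, 3, 4} \<Longrightarrow> \<exists>p\<in>{..<5}. bulk m r \<subseteq> page7 m p"
  using page7_eqs(1)[of m] page7_eqs(2)[of m] page7_eqs(4)[of m] page7_eqs(5)[of m]
  by auto

lemma page7_cover:
  assumes "e \<in> edges (circulant (4 * m + 7) {1, 3})"
  shows "\<exists>p\<in>{..<5}. \<exists>u v. e = {u, v} \<and> (place7 m u, place7 m v) \<in> page7 m p"
proof -
  have cover: ?thesis if "e = {u, v}" "(place7 m u, place7 m v) \<in> page7 m p" "p < 5" for p u v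
    using that by blast
  note page_simps = place7_def page7_eqs[simplified] doubleton_eq_iff
  have "(7::nat) \<le> 7"
    by simp
  with assms show ?thesis
  proof (cases rule: circulant_1_3_edge_cases[consumes 2])
    case (1 j)
    then obtain p where "p < 5" "(j, j + 3) \<in> page7 m p"
      using bulk_covered[where page = "page7 m", OF page7_bulk] by blast
    then show ?thesis
      using 1 by (intro cover[of j "j + 3" p]) (simp_all add: place7_def)
  next
    case (2 j)
    then obtain p where "p < 5" "(j + 1, j + 2) \<in> page7 m p"
      using bulk_covered[where page = "page7 m", OF page7_bulk] by blast
    then show ?thesis
      using 2 by (intro cover[of "j + 1" "j + 2" p]) (simp_all add: place7_def)
  next
    case 3
    then show ?thesis
      using cover[of 1 2 4] by (simp add: page_simps)
  next
    case 4
    then show ?thesis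
      using cover[of 1 "4 * m + 7" 0] by (simp add: page_simps)
  next
    case 5
    then show ?thesis
      using cover[of 1 "4 * m + 5" 3] by (simp add: page_simps)
  next
    case 6
    then show ?thesis
      using cover[of 2 "4 * m + 6" 0] by (simp add: page_simps)
  next
    case 7
    then show ?thesis
      using cover[of 3 "4 * m + 7" 4] by (simp add: page_simps)
  next
    case (8 i)
    then consider "i = 1" | "i = 2" | "i = 3" | "i = 4"
      by linarith
    then show ?thesis
      using \<open>e = _\<close>
        cover[of "4 * m + 1" "4 * m + 4" 2] cover[of "4 * m + 2" "4 * m + 5" 2]
        cover[of "4 * m + 3" "4 * m + 6" 1] cover[of "4 * m + 4" "4 * m + 7" 3]
      by cases (simp_all add: page_simps)
  next
    case (9 i)
    \<comment> \<open>For \<open>i = 4\<close> the witness lists the endpoints in reverse, since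
      vertex \<open>4 * m + 5\<close> has the smaller place.\<close>
    then consider "i = 2" | "i = 3" | "i = 4" | "i = 5" | "i = 6"
      by linarith
    then show ?thesis
      using \<open>e = _\<close>
        cover[of "4 * m + 2" "4 * m + 3" 3] cover[of "4 * m + 3" "4 * m + 4" 0]
        cover[of "4 * m + 5" "4 * m + 4" 1] cover[of "4 * m + 5" "4 * m + 6" 4]
        cover[of "4 * m + 6" "4 * m + 7" 2]
      by cases (simp_all add: page_simps)
  qed
qed

lemma page9_bulk: "r \<in> {1, 2, 3, 4} \<Longrightarrow> \<exists>p\<in>{..<5}. bulk m r \<subseteq> page9 m p"
  using page9_eqs(1)[of m] page9_eqs(2)[of m] page9_eqs(4)[of m] page9_eqs(5)[of m]
  by auto

lemma page9_cover:
  assumes "e \<in> edges (circulant (4 * m + 9) {1, 3})"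
  shows "\<exists>p\<in>{..<5}. \<exists>u v. e = {u, v} \<and> (u, v) \<in> page9 m p"
proof -
  have cover: ?thesis if "e = {u, v}" "(u, v) \<in> page9 m p" "p < 5" for p u v
    using that by blast
  note page_simps = page9_eqs[simplified] doubleton_eq_iff
  have "(7::nat) \<le> 9"
    by simp
  with assms show ?thesis
  proof (cases rule: circulant_1_3_edge_cases[consumes 2])
    case (1 j)
    then obtain p where "p < 5" "(j, j + 3) \<in> page9 m p"
      using bulk_covered[where page = "page9 m", OF page9_bulk] by blast
    then show ?thesis
      using 1 by (intro cover[of j "j + 3" p]) simp_all
  next
    case (2 j)
    then obtain p where "p < 5" "(j + 1, j + 2) \<in> page9 m p"
      using bulk_covered[where page = "page9 m", OF page9_bulk] by blast
    then show ?thesis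
      using 2 by (intro cover[of "j + 1" "j + 2" p]) simp_all
  next
    case 3
    then show ?thesis
      using cover[of 1 2 1] by (simp add: page_simps)
  next
    case 4
    then show ?thesis
      using cover[of 1 "4 * m + 9" 0] by (simp add: page_simps)
  next
    case 5
    then show ?thesis
      using cover[of 1 "4 * m + 7" 3] by (simp add: page_simps)
  next
    case 6
    then show ?thesis
      using cover[of 2 "4 * m + 8" 0] by (simp add: page_simps)
  next
    case 7
    then show ?thesis
      using cover[of 3 "4 * m + 9" 1] by (simp add: page_simps)
  next
    case (8 i)
    then consider "i = 1" | "i = 2" | "i = 3" | "i = 4" | "i = 5" | "i = 6"
      by linarith
    then show ?thesis
      using \<open>e = _\<close>
        cover[of "4 * m + 1" "4 * m + 4" 2] cover[of "4 * m + 2" "4 * m + 5" 3]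
        cover[of "4 * m + 3" "4 * m + 6" 0] cover[of "4 * m + 4" "4 * m + 7" 1]
        cover[of "4 * m + 5" "4 * m + 8" 2] cover[of "4 * m + 6" "4 * m + 9" 4]
      by cases (simp_all add: page_simps)
  next
    case (9 i)
    then consider "i = 2" | "i = 3" | "i = 4" | "i = 5" | "i = 6" | "i = 7" | "i = 8"
      by linarith
    then show ?thesis
      using \<open>e = _\<close>
        cover[of "4 * m + 2" "4 * m + 3" 2] cover[of "4 * m + 3" "4 * m + 4" 3]
        cover[of "4 * m + 4" "4 * m + 5" 0] cover[of "4 * m + 5" "4 * m + 6" 1]
        cover[of "4 * m + 6" "4 * m + 7" 2] cover[of "4 * m + 7" "4 * m + 8" 4]
        cover[of "4 * m + 8" "4 * m + 9" 3]
      by cases (simp_all add: page_simps)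
  qed
qed

theorem theorem2:
  fixes n :: nat
  assumes "n \<ge> 7" and "odd n"
  shows "nearly_dispersable (circulant n {1, 3})"
proof -
  define G where "G = circulant n {1, 3}"
  have G: "finite_simple_graph G"
    unfolding G_def using assms(1) by (intro finite_simple_graph_circulant) auto
  have verts: "verts G = {1..n}"
    by (simp add: G_def circulant_def)
  have deg: "vertex_degree G v = 4" if "v \<in> verts G" for v
    using vertex_degree_circulant_1_3[OF assms(1)] that unfolding verts by (simp add: G_def)
  then have "vertex_degree G ` verts G = {4}"
    using assms(1) by (force simp: verts)
  then have max: "max_degree G = 4"
    by (simp add: max_degree_def)
  have lower: "4 < num_pages G c" if "matching_book_embedding G \<omega> c" for \<omega> c
    using odd_regular_graph_num_pages[OF G _ deg _ that] assms(2) by (simp add: verts)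
  have "\<exists>\<omega> c. matching_book_embedding G \<omega> c \<and> c ` edges G \<subseteq> {..<5}"
  proof -
    \<comment> \<open>As \<open>n\<close> is odd, \<open>n - 7\<close> is 0 or 2 mod 4, which
      selects the base graph on 7 or on 9 vertices.\<close>
    have "n = 4 * ((n - 7) div 4) + 7 \<or> n = 4 * ((n - 7) div 4) + 9"
      using assms by presburger
    then consider m where "n = 4 * m + 7" | m where "n = 4 * m + 9"
      by blast
    then show ?thesis
    proof cases
      case (1 m)
      then have "bij_betw (place7 m) (verts G) {1..card (verts G)}"
        using bij_betw_place7 unfolding verts card_atLeastAtMost diff_Suc_1 by blast
      moreover have "\<exists>p\<in>{..<5}. \<exists>u v. e = {u, v} \<and> (place7 m u, place7 m v) \<in> page7 m p"
        if "e \<in> edges G" for e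
        using page7_cover that unfolding G_def 1 by blast
      ultimately show ?thesis
        using page7_less pairwise_separate_page7
        by (intro matching_book_embedding_if_separate_pages[OF G, where page = "page7 m"]) auto
    next
      case (2 m)
      have "bij_betw id (verts G) {1..card (verts G)}"
        by (simp add: verts)
      moreover have "\<exists>p\<in>{..<5}. \<exists>u v. e = {u, v} \<and> (id u, id v) \<in> page9 m p"
        if "e \<in> edges G" for e
        using page9_cover that unfolding G_def 2 id_apply by blast
      ultimately show ?thesis
        using page9_less pairwise_separate_page9
        by (intro matching_book_embedding_if_separate_pages[OF G, where page = "page9 m"]) auto
    qed
  qed
  then obtain \<omega> c where emb: "matching_book_embedding G \<omega> c" and sub: "c ` edges G \<subseteq> {..<5}"
    by blast
  then have "num_pages G c \<le> 5"
    using card_mono[OF _ sub] by (simp add: num_pages_def)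
  \<comment> \<open>The construction gives at most five pages; the parity bound forces all five to
    be used.\<close>
  with lower[OF emb] have "num_pages G c = 1 + max_degree G"
    by (simp add: max)
  moreover have "\<not> dispersable G"
    using lower max by (fastforce simp: dispersable_def)
  ultimately show ?thesis
    using emb unfolding nearly_dispersable_def G_def by blast
qed

end
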